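(* Let $\bar x\in\mathcal{SE}$. Suppose that: (i) $f$ is $B$-differentiable at $\bar x$, uniformly on $K$, with family of derivatives $\{D_Bf(\bar x,z):\ z\in K\}$; (ii) a local error bound is valid near $\bar x$, i.e. there exist $\kappa>0$ and $\delta>0$ such that $\mathrm{dist}(x;\mathcal{SE})\le\kappa\,\nu(x)$ for all $x\in B(\bar x;\delta)\cap K$. Then $$\bigcap_{z\in K}D_Bf(\bar x,z)^{-1}(C)\cap T_{\rm r}(\bar x;K)\subseteq T(\bar x;\mathcal{SE}).$$
   Context: Setting: $f:\mathbb{R}^n\times\mathbb{R}^n\to\mathbb{R}^m$ is a mapping, $C\subset\mathbb{R}^m$ is a nontrivial closed, convex, pointed cone, and $K\subseteq\mathbb{R}^n$ is a nonempty closed set. The strong vector equilibrium problem asks for $x\in K$ with $f(x,z)\in C$ for all $z\in K$; its solution set is $\mathcal{SE}=\{x\in K:\ f(x,z)\in C\ \ \forall z\in K\}$. Notation: $B(x;r)$ is the closed ball of center $x$ and radius $r$; $\mathrm{dist}(x;S)$ is the Euclidean distance of $x$ from the set $S$. The function $\nu$ is defined by $\nu(x)=\sup_{z\in K}\mathrm{dist}(f(x,z);C)\in[0,+\infty]$. For a set $S\subseteq\mathbb{R}^n$ and $\bar x\in S$: the contingent cone is $T(\bar x;S)=\{v\in\mathbb{R}^n:\ \exists v_k\to v,\ \exists t_k\downarrow0:\ \bar x+t_kv_k\in S\ \forall k\in\mathbb{N}\}$; the cone of radial directions is $T_{\rm r}(\bar x;S)=\{v\in\mathbb{R}^n:\ \forall\epsilon>0\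 \exists t_\epsilon\in(0,\epsilon):\ \bar x+t_\epsilon v\in S\}$. $\mathcal{PH}(\mathbb{R}^n,\mathbb{R}^m)$ is the space of continuous positively homogeneous mappings from $\mathbb{R}^n$ to $\mathbb{R}^m$. $f$ is $B$-differentiable at $\bar x\in K$, uniformly on $K$, if there is a family $\{D_Bf(\bar x,z)\in\mathcal{PH}(\mathbb{R}^n,\mathbb{R}^m):\ z\in K\}$ such that for every $\epsilon>0$ there is $\delta_\epsilon>0$ with $$\sup_{z\in K}\frac{\|f(x,z)-f(\bar x,z)-D_Bf(\bar x,z)(x-\bar x)\|}{\|x-\bar x\|}<\epsilon\quad\forall x\in B(\bar x;\delta_\epsilon),\ x\neq\bar x.$$ $D_Bf(\bar x,z)^{-1}(C)$ denotes the preimage $\{v\in\mathbb{R}^n:\ D_Bf(\bar x,z)(v)\in C\}$. *)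

theory Defs
  imports "HOL-Analysis.Analysis"
begin

definition pointed_set :: "'a::real_vector set \<Rightarrow> bool" where
  "pointed_set C \<longleftrightarrow> C \<inter> uminus ` C = {0}"

definition SE ::
  "(real ^ 'n \<Rightarrow> real ^ 'n \<Rightarrow> real ^ 'm) \<Rightarrow> (real ^ 'm) set \<Rightarrow> (real ^ 'n) set \<Rightarrow> (real ^ 'n) set" where
  "SE f C K = {x \<in> K. \<forall>z \<in> K. f x z \<in> C}"

(* The value may be top, hence ennreal. Library pitfall: infdist x {} = 0; C is nonempty in use. *)
definition merit ::
  "(real ^ 'n \<Rightarrow> real ^ 'n \<Rightarrow> real ^ 'm) \<Rightarrow> (real ^ 'm) set \<Rightarrow> (real ^ 'n) set \<Rightarrow> real ^ 'n \<Rightarrow> ennreal" where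
  "merit f C K x = (SUP z\<in>K. ennreal (infdist (f x z) C))"

(* t \<down> 0 is read as convergence to 0 through positive values, monotonicity not being required
   (passing to a subsequence makes t strictly decreasing, so the cone is the same). *)
definition contingent_cone :: "real ^ 'n \<Rightarrow> (real ^ 'n) set \<Rightarrow> (real ^ 'n) set" where
  "contingent_cone x S =
     {v. \<exists>(w :: nat \<Rightarrow> real ^ 'n) (t :: nat \<Rightarrow> real).
           w \<longlonglongrightarrow> v \<and> (\<forall>k. t k > 0) \<and> t \<longlonglongrightarrow> 0 \<and> (\<forall>k. x + t k *\<^sub>R w k \<in> S)}"

definition radial_cone :: "real ^ 'n \<Rightarrow> (real ^ 'n) set \<Rightarrow> (real ^ 'n) set" where
  "radial_cone x S = {v. \<forall>\<epsilon>>0. \<exists>t\<in>{0<..<\<epsilon>}. x + t *\<^sub>R v \<in> S}"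

definition PH :: "(real ^ 'n \<Rightarrow> real ^ 'm) set" where
  "PH = {h. continuous_on UNIV h \<and> (\<forall>t>0. \<forall>v. h (t *\<^sub>R v) = t *\<^sub>R h v)}"

(* Only the members D z with z in K belong to the family. The supremum is taken in ennreal,
   since a real-valued SUP over an unbounded set would be unspecified. *)
definition has_uniform_B_derivative ::
  "(real ^ 'n \<Rightarrow> real ^ 'n \<Rightarrow> real ^ 'm) \<Rightarrow> (real ^ 'n \<Rightarrow> real ^ 'n \<Rightarrow> real ^ 'm)
     \<Rightarrow> real ^ 'n \<Rightarrow> (real ^ 'n) set \<Rightarrow> bool" where
  "has_uniform_B_derivative f D xbar K \<longleftrightarrow>
     (\<forall>z\<in>K. D z \<in> PH) \<and>
     (\<forall>\<epsilon>>0. \<exists>\<delta>>0. \<forall>x\<in>cball xbar \<delta>. x \<noteq> xbar \<longrightarrow>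
        (SUP z\<in>K. ennreal (norm (f x z - f xbar z - D z (x - xbar)) / norm (x - xbar))) < ennreal \<epsilon>)"

end

theory Submission
  imports Defs
begin

text \<open>
  Along admissible radial steps \<open>x = xbar + t v\<close>, the point \<open>f xbar z + t D z v\<close> lies in \<open>C\<close> for
  every \<open>z \<in> K\<close>, so \<open>f x z\<close> is within \<open>o(t)\<close> of \<open>C\<close>, uniformly in \<open>z\<close>. The error bound turns this
  into a solution at distance \<open>o(t)\<close> from \<open>x\<close>, which makes \<open>v\<close> a contingent direction.
\<close>

text \<open>This trades the sequences of the contingent cone for one tolerance that bounds both the
  step length and the error relative to it. Taking the tolerance \<open>1 / (k + 1)\<close> at stage
  \<open>k\<close> then forces both limits at once.\<close>

lemma contingent_coneI:
  fixes x v :: "real ^ 'n"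
  assumes "\<And>\<epsilon>. \<epsilon> > 0 \<Longrightarrow> \<exists>t\<in>{0<..<\<epsilon>}. \<exists>s\<in>S. dist s (x + t *\<^sub>R v) < \<epsilon> * t"
  shows "v \<in> contingent_cone x S"
proof -
  have "\<exists>t\<in>{0<..<inverse (real (Suc k))}. \<exists>s\<in>S.
          dist s (x + t *\<^sub>R v) < inverse (real (Suc k)) * t" for k
    by (rule assms) simp
  then obtain t s where t: "\<And>k. 0 < t k" "\<And>k. t k < inverse (real (Suc k))"
    and s: "\<And>k. s k \<in> S" "\<And>k. dist (s k) (x + t k *\<^sub>R v) < inverse (real (Suc k)) * t k"
    by (simp add: Bex_def greaterThanLessThan_iff) metis
  \<comment> \<open>The direction that leads from \<open>x\<close> exactly to \<open>s k\<close> in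
    a step of length \<open>t k\<close>; dividing by \<open>t k\<close> turns the relative error
    into a bound on \<open>dist (w k) v\<close>.\<close>
  define w where "w k = (1 / t k) *\<^sub>R (s k - x)" for k
  have sw: "s k = x + t k *\<^sub>R w k" for k
    using t(1)[of k] by (simp add: w_def)
  have "t k * dist (w k) v = dist (s k) (x + t k *\<^sub>R v)" for k
    using t(1)[of k] unfolding sw dist_norm
    by (simp add: scaleR_diff_right[symmetric])
  then have "dist (w k) v < inverse (real (Suc k))" for k
    using s(2)[of k] t(1)[of k] by (metis mult.commute mult_less_cancel_left_pos)
  then have "(\<lambda>k. dist (w k) v) \<longlonglongrightarrow> 0"
    by (intro tendsto_sandwich[OF _ _ tendsto_const LIMSEQ_inverse_real_of_nat] always_eventually)
       (auto intro: less_imp_le)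
  then have "w \<longlonglongrightarrow> v"
    by (rule tendsto_dist_iff[THEN iffD2])
  moreover have "t \<longlonglongrightarrow> 0"
    by (intro tendsto_sandwich[OF _ _ tendsto_const LIMSEQ_inverse_real_of_nat] always_eventually)
       (auto intro: less_imp_le t simp del: of_nat_Suc)
  ultimately show ?thesis
    unfolding contingent_cone_def using t(1) s(1) sw by auto
qed

text \<open>Each term of a supremum lies below it, so the extended-real condition yields a real
  estimate whose radius does not depend on \<open>z\<close>.\<close>

lemma uniform_B_derivative_remainder:
  fixes f D :: "real ^ 'n \<Rightarrow> real ^ 'n \<Rightarrow> real ^ 'm"
  assumes "has_uniform_B_derivative f D xbar K" "\<epsilon> > 0"
  obtains \<delta> where "\<delta> > 0"
    "\<And>x z. \<lbrakk>x \<in> cball xbar \<delta>; x \<noteq> xbar; z \<in> K\<rbrakk> \<Longrightarrow>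
       norm (f x z - f xbar z - D z (x - xbar)) \<le> \<epsilon> * norm (x - xbar)"
proof -
  obtain \<delta> where "\<delta> > 0" and \<delta>: "\<And>x. x \<in> cball xbar \<delta> \<Longrightarrow> x \<noteq> xbar \<Longrightarrow>
      (SUP z\<in>K. ennreal (norm (f x z - f xbar z - D z (x - xbar)) / norm (x - xbar))) < ennreal \<epsilon>"
    using assms unfolding has_uniform_B_derivative_def by blast
  show thesis
  proof (rule that[OF \<open>\<delta> > 0\<close>])
    fix x z assume x: "x \<in> cball xbar \<delta>" "x \<noteq> xbar" and "z \<in> K"
    have "ennreal (norm (f x z - f xbar z - D z (x - xbar)) / norm (x - xbar)) < ennreal \<epsilon>"
      using SUP_upper[OF \<open>z \<in> K\<close>] \<delta>[OF x] by (rule le_less_trans)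
    then have "norm (f x z - f xbar z - D z (x - xbar)) / norm (x - xbar) < \<epsilon>"
      by (simp add: ennreal_less_iff)
    then show "norm (f x z - f xbar z - D z (x - xbar)) \<le> \<epsilon> * norm (x - xbar)"
      using x(2) by (simp add: divide_less_eq)
  qed
qed

lemma merit_le:
  assumes "\<And>z. z \<in> K \<Longrightarrow> \<exists>c\<in>C. dist (f x z) c \<le> r"
  shows "merit f C K x \<le> ennreal r"
  unfolding merit_def
proof (rule SUP_least)
  fix z assume "z \<in> K"
  with assms obtain c where "c \<in> C" "dist (f x z) c \<le> r" by blast
  then show "ennreal (infdist (f x z) C) \<le> ennreal r"
    by (intro ennreal_leI infdist_le2)
qed

theorem theorem3p1:
  fixes f :: "real ^ 'n \<Rightarrow> real ^ 'n \<Rightarrow> real ^ 'm"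
    and D :: "real ^ 'n \<Rightarrow> real ^ 'n \<Rightarrow> real ^ 'm"
    and C :: "(real ^ 'm) set"
    and K :: "(real ^ 'n) set"
    and xbar :: "real ^ 'n"
  assumes "convex_cone C" and "closed C" and "pointed_set C"
    and "C \<noteq> {0}" and "C \<noteq> UNIV"
    and "K \<noteq> {}" and "closed K"
    and "xbar \<in> SE f C K"
    and "has_uniform_B_derivative f D xbar K"
    and "\<exists>\<kappa>>0. \<exists>\<delta>>0. \<forall>x \<in> cball xbar \<delta> \<inter> K.
           ennreal (infdist x (SE f C K)) \<le> ennreal \<kappa> * merit f C K x"
  shows "(\<Inter>z\<in>K. D z -` C) \<inter> radial_cone xbar K \<subseteq> contingent_cone xbar (SE f C K)"
proof
  fix v assume v: "v \<in> (\<Inter>z\<in>K. D z -` C) \<inter> radial_cone xbar K"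
  obtain \<kappa> \<delta> where "\<kappa> > 0" "\<delta> > 0" and error_bound:
    "\<And>x. x \<in> cball xbar \<delta> \<Longrightarrow> x \<in> K \<Longrightarrow> ennreal (infdist x (SE f C K)) \<le> ennreal \<kappa> * merit f C K x"
    using assms(10) by blast
  show "v \<in> contingent_cone xbar (SE f C K)"
  proof (rule contingent_coneI)
    fix \<epsilon> :: real assume "\<epsilon> > 0"
    show "\<exists>t\<in>{0<..<\<epsilon>}. \<exists>s\<in>SE f C K. dist s (xbar + t *\<^sub>R v) < \<epsilon> * t"
    \<comment> \<open>The zero direction is split off because the constants below divide by
      \<open>norm v\<close> and the remainder estimate needs a point other than \<open>xbar\<close>.
      Here \<open>xbar\<close> itself is the required solution.\<close>
    proof (cases "v = 0")
      case True
      with \<open>\<epsilon> > 0\<close> assms(8) show ?thesis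
        by (intro bexI[of _ "\<epsilon> / 2"] bexI[of _ xbar]) auto
    next
      case False
      \<comment> \<open>Chosen so that
        \<open>\<kappa> * \<eta> * (t * norm v) = \<epsilon> * t / 2\<close>; the factor 2 leaves
        room for a strict inequality at the end.\<close>
      define \<eta> where "\<eta> = \<epsilon> / (2 * \<kappa> * norm v)"
      have "\<eta> > 0"
        using \<open>\<epsilon> > 0\<close> \<open>\<kappa> > 0\<close> False by (simp add: \<eta>_def)
      with assms(9) obtain \<rho> where "\<rho> > 0" and remainder:
        "\<And>x z. \<lbrakk>x \<in> cball xbar \<rho>; x \<noteq> xbar; z \<in> K\<rbrakk> \<Longrightarrow>
           norm (f x z - f xbar z - D z (x - xbar)) \<le> \<eta> * norm (x - xbar)"
        by (rule uniform_B_derivative_remainder) blast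
      \<comment> \<open>A step shorter than \<open>b\<close> is below \<open>\<epsilon>\<close> and
        keeps the point in the balls of both the error bound and the remainder estimate.\<close>
      define b where "b = min \<epsilon> (min (\<delta> / norm v) (\<rho> / norm v))"
      have "b > 0"
        using \<open>\<epsilon> > 0\<close> \<open>\<delta> > 0\<close> \<open>\<rho> > 0\<close> False by (simp add: b_def)
      with v have "\<exists>t\<in>{0<..<b}. xbar + t *\<^sub>R v \<in> K"
        unfolding radial_cone_def by blast
      then obtain t where "0 < t" "t < b" and xK: "xbar + t *\<^sub>R v \<in> K"
        by auto
      define x where "x = xbar + t *\<^sub>R v"
      have "t < \<epsilon>" "t * norm v < \<delta>" "t * norm v < \<rho>"
        using \<open>t < b\<close> False by (auto simp: b_def less_divide_eq)
      then have x: "x \<in> cball xbar \<delta>" "x \<in> cball xbar \<rho>" "x \<noteq> xbar" "norm (x - xbar) = t * norm v"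
        using \<open>0 < t\<close> False by (auto simp: x_def dist_norm)
      have "merit f C K x \<le> ennreal (\<eta> * (t * norm v))"
      proof (rule merit_le)
        fix z assume "z \<in> K"
        have "D z \<in> PH"
          using assms(9) \<open>z \<in> K\<close> unfolding has_uniform_B_derivative_def by blast
        then have "D z (x - xbar) = t *\<^sub>R D z v"
          using \<open>0 < t\<close> by (simp add: PH_def x_def)
        moreover have "f xbar z \<in> C" "D z v \<in> C"
          using assms(8) v \<open>z \<in> K\<close> by (auto simp: SE_def)
        \<comment> \<open>A convex cone is closed under sums and positive multiples, so the
          first-order model of \<open>f x z\<close> stays in \<open>C\<close>; only the remainder
          separates \<open>f x z\<close> from \<open>C\<close>.\<close>
        ultimately have "f xbar z + D z (x - xbar) \<in> C"
          using assms(1) \<open>0 < t\<close> by (simp add: convex_cone_add convex_cone_scaleR)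
        moreover have "dist (f x z) (f xbar z + D z (x - xbar)) \<le> \<eta> * (t * norm v)"
          using remainder[OF x(2,3) \<open>z \<in> K\<close>] x(4) by (simp add: dist_norm diff_diff_eq)
        ultimately show "\<exists>c\<in>C. dist (f x z) c \<le> \<eta> * (t * norm v)" ..
      qed
      then have "ennreal \<kappa> * merit f C K x \<le> ennreal \<kappa> * ennreal (\<eta> * (t * norm v))"
        by (rule mult_left_mono) simp
      also have "\<dots> = ennreal (\<epsilon> * t / 2)"
        using \<open>\<kappa> > 0\<close> False by (simp add: ennreal_mult'[symmetric] \<eta>_def field_simps)
      finally have "ennreal (infdist x (SE f C K)) \<le> ennreal (\<epsilon> * t / 2)"
        using error_bound[OF x(1)] xK x_def by force
      then have "infdist x (SE f C K) \<le> \<epsilon> * t / 2"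
        using \<open>\<epsilon> > 0\<close> \<open>0 < t\<close> by (simp add: ennreal_le_iff)
      also have "\<dots> < \<epsilon> * t"
        using \<open>\<epsilon> > 0\<close> \<open>0 < t\<close> by simp
      \<comment> \<open>Since \<open>xbar\<close> is a solution, \<open>infdist\<close> is a genuine
        infimum here and not the default 0 of the empty set. Strictness then gives a solution close
        enough to \<open>x\<close> without the infimum having to be attained.\<close>
      finally have "(INF s\<in>SE f C K. dist x s) < \<epsilon> * t"
        using assms(8) by (auto simp: infdist_def split: if_splits)
      then obtain s where "s \<in> SE f C K" "dist x s < \<epsilon> * t"
        using assms(8) by (subst (asm) cINF_less_iff) auto
      then show ?thesis
        using \<open>0 < t\<close> \<open>t < \<epsilon>\<close> by (auto simp: x_def dist_commute)
    qed
  qed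
qed

end
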